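(* Let $t_0<T<+\infty$ and let $a,b,c,d$ and $a_k,b_k,c_k,d_k$ ($k=1,2$) be real-valued continuous functions on $[t_0,T]$. For $k=1,2$ let $y_k(t)$ be a solution on $[t_0,T]$ of $$y'+a_k(t)y^3+b_k(t)y^2+c_k(t)y+d_k(t)=0,$$ such that $y_1(t_0)\le y_2(t_0)$, $y_1(t_0)\le y_1(T)$ and $y_2(t_0)\ge y_2(T)$. Assume: (i) $a(t)<0$ almost everywhere on $[t_0,T]$, and the function $\frac{b^2(t)}{a(t)}$ is integrable on $[t_0,T]$; (ii) for some $\gamma_1\in[y_1(t_0),y_2(t_0)]$, $$\gamma_1-y_1(t_0)+\int_{t_0}^{t}\exp\Big\{\int_{t_0}^{\tau}\Big[c(s)-\frac{b^2(s)}{a(s)}\Big]ds\Big\}\Big[(a_1(\tau)-a(\tau))y_1^3(\tau)+(b_1(\tau)-b(\tau))y_1^2(\tau)+(c_1(\tau)-c(\tau))y_1(\tau)+d_1(\tau)-d(\tau)\Big]d\tau\ge0$$ for all $t\in[t_0,T]$; (iii) for some $\gamma_2\in[\gamma_1,y_2(t_0)]$, $$\gamma_2-y_2(t_0)+\int_{t_0}^{t}\exp\Big\{\int_{t_0}^{\tau}\Big[c(s)-\frac{b^2(s)}{a(s)}\Big]ds\Big\}\Big[(a_2(\tau)-a(\tau))y_2^3(\tau)+(b_2(\tau)-b(\tau))y_2^2(\tau)+(c_2(\tau)-c(\tau))y_2(\tau)+d_2(\tau)-d(\tau)\Big]d\tau\le0$$ for all $t\in[t_0,T]$. Then the equation $$y'+a(t)y^3+b(t)y^2+c(t)y+d(t)=0$$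 has a closed solution on $[t_0,T]$.
   Context: A solution $y(t)$ of the equation, existing on an interval $[t_0,T]$, is called closed on $[t_0,T]$ if $y(t_0)=y(T)$. A solution on an interval is a real-valued differentiable function satisfying the equation at every point of the interval (one-sided derivatives at the endpoints). "Integrable" means Lebesgue integrable. *)

theory Defs
  imports "HOL-Analysis.Analysis"
begin

text \<open>
  At the endpoints of the interval the derivative within \<open>{t0..T}\<close> is the one-sided one.
\<close>

definition abel_solution ::
  "(real \<Rightarrow> real) \<Rightarrow> (real \<Rightarrow> real) \<Rightarrow> (real \<Rightarrow> real) \<Rightarrow> (real \<Rightarrow> real) \<Rightarrow>
   real \<Rightarrow> real \<Rightarrow> (real \<Rightarrow> real) \<Rightarrow> bool" where
  "abel_solution a b c d t0 T y \<longleftrightarrow>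
     (\<exists>y'. \<forall>t\<in>{t0..T}.
        (y has_real_derivative y' t) (at t within {t0..T}) \<and>
        y' t + a t * y t ^ 3 + b t * y t ^ 2 + c t * y t + d t = 0)"

definition closed_abel_solution ::
  "(real \<Rightarrow> real) \<Rightarrow> (real \<Rightarrow> real) \<Rightarrow> (real \<Rightarrow> real) \<Rightarrow> (real \<Rightarrow> real) \<Rightarrow>
   real \<Rightarrow> real \<Rightarrow> (real \<Rightarrow> real) \<Rightarrow> bool" where
  "closed_abel_solution a b c d t0 T y \<longleftrightarrow> abel_solution a b c d t0 T y \<and> y t0 = y T"

end

theory Submission
  imports Defs
begin

text \<open>
  The closed solution is found by running the equation backwards. With \<open>x s = y (- s)\<close> it reads
  \<open>x' = a x\<^sup>3 + b x\<^sup>2 + c x + d\<close>, and now the cubic term, whose coefficient is nonpositive, pulls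
  solutions of large modulus towards zero. The other superlinear term is the quadratic one, and by
  Young's inequality \<open>\<bar>b\<bar> w\<^sup>2 \<le> \<bar>a\<bar> w\<^sup>3 / 2 + b\<^sup>2 w / (2 \<bar>a\<bar>)\<close>: half of the cubic
  damping turns it into a linear growth rate, which is integrable because \<open>b\<^sup>2 / a\<close> is. The other half
  of the damping gives a decay rate of at least \<open>N \<bar>a\<bar> / 2\<close> wherever \<open>w\<^sup>2 \<ge> N\<close>. Since \<open>a\<close> has a strictly
  negative integral, \<open>N\<close> can be chosen so large that over the whole interval decay outweighs growth;
  starting high enough keeps the curve above \<open>N\<close> throughout. The exponential \<open>w\<close> with this net rate is
  thus an upper solution that ends no higher than it starts, and \<open>- w\<close> is a lower solution that ends no
  lower than it starts. This is \<open>cubic_closed_solution\<close>.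

  Between such a pair of curves there is always a closed solution
  (\<open>closed_solution_between_lower_upper\<close>): truncating the right-hand side at the two curves
  makes it globally Lipschitz, the curves confine the solutions of the truncated equation, and so the
  map from initial to final value sends an interval continuously into itself. It has a fixed point by
  the intermediate value theorem. The flow of the truncated equation, with its continuous dependence
  on the initial value, comes from Banach's fixed point theorem (\<open>lipschitz_flow\<close>).
\<close>

section \<open>The flow of a Lipschitz equation\<close>

text \<open>
  Picard's theorem on the whole interval at once. The integral operator is a contraction in the norm
  weighted by \<open>exp (- 2 K (t - a))\<close>, with factor \<open>1/2\<close> whatever the length of the interval. The initial
  value enters the operator as an added constant, so its fixed point is Lipschitz in the initial value.
\<close>

lemma lipschitz_flow:
  fixes G :: "real \<Rightarrow> real \<Rightarrow> real"
  assumes ab: "a \<le> b"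
    and cont: "continuous_on ({a..b} \<times> UNIV) (\<lambda>(t,x). G t x)"
    and lip: "\<And>t x y. t \<in> {a..b} \<Longrightarrow> \<bar>G t x - G t y\<bar> \<le> L * \<bar>x - y\<bar>"
  obtains \<phi> where "\<And>x. \<phi> x a = x"
    and "\<And>x t. t \<in> {a..b} \<Longrightarrow> (\<phi> x has_real_derivative G t (\<phi> x t)) (at t within {a..b})"
    and "\<And>t. t \<in> {a..b} \<Longrightarrow> continuous_on UNIV (\<lambda>x. \<phi> x t)"
proof -
  define K where "K = max L 1"
  have K: "K > 0" by (simp add: K_def)
  have lipK: "\<bar>G t x - G t y\<bar> \<le> K * \<bar>x - y\<bar>" if "t \<in> {a..b}" for t x y
    using lip[OF that, of x y] mult_right_mono[of L K "\<bar>x - y\<bar>"] by (simp add: K_def)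
  \<comment> \<open>Clamping to the interval extends functions on it to bounded continuous functions on the line.\<close>
  define r where "r t = max a (min b t)" for t
  have r: "r t \<in> {a..b}" for t using ab by (auto simp: r_def)
  have r_id: "r t = t" if "t \<in> {a..b}" for t using that by (auto simp: r_def)
  \<comment> \<open>The unknown is \<open>g t = exp (- 2 K (t - a)) x t\<close>: its supremum norm is the weighted norm of \<open>x\<close>.\<close>
  define h where "h g = (\<lambda>\<tau>. G \<tau> (exp (2 * K * (\<tau> - a)) * g \<tau>))" for g :: "real \<Rightarrow> real"
  define I where "I x g t = exp (- 2 * K * (t - a)) * (x + integral {a..t} (h g))"
    for x t and g :: "real \<Rightarrow> real"
  have h_cont: "continuous_on {a..b} (h g)" if "continuous_on {a..b} g" for g
  proof -
    have "continuous_on {a..b} ((\<lambda>(t,x). G t x) \<circ> (\<lambda>\<tau>. (\<tau>, exp (2 * K * (\<tau> - a)) * g \<tau>)))"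
      by (intro continuous_on_compose continuous_on_subset[OF cont] continuous_intros that) auto
    then show ?thesis by (simp add: h_def o_def)
  qed
  have I_cont: "continuous_on {a..b} (I x g)" if "continuous_on {a..b} g" for x g
    unfolding I_def
    by (intro continuous_intros indefinite_integral_continuous_1
        integrable_continuous_real h_cont that)
  have ext: "(\<lambda>t. I x g (r t)) \<in> bcontfun" if "continuous_on {a..b} g" for x g
  proof -
    have "continuous_on UNIV (I x g \<circ> r)"
    proof (rule continuous_on_compose)
      show "continuous_on UNIV r" unfolding r_def by (intro continuous_intros)
      show "continuous_on (r ` UNIV) (I x g)"
        by (rule continuous_on_subset[OF I_cont[OF that]]) (use r in auto)
    qed
    moreover have "bounded (I x g ` {a..b})"
      by (intro compact_imp_bounded compact_continuous_image I_cont that compact_Icc)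
    then have "bounded (range (\<lambda>t. I x g (r t)))"
      by (rule bounded_subset) (use r in auto)
    ultimately show ?thesis by (simp add: bcontfun_def o_def)
  qed
  define \<Phi> where "\<Phi> x g = Bcontfun (\<lambda>t. I x (apply_bcontfun g) (r t))"
    for x and g :: "real \<Rightarrow>\<^sub>C real"
  have \<Phi>: "apply_bcontfun (\<Phi> x g) t = I x (apply_bcontfun g) (r t)" for x g t
    unfolding \<Phi>_def by (subst Bcontfun_inverse) (auto intro: ext)
  have I_dist: "\<bar>I x f t - I y g t\<bar> \<le> \<bar>x - y\<bar> + dist f g / 2"
    if t: "t \<in> {a..b}" for x y t and f g :: "real \<Rightarrow>\<^sub>C real"
  proof -
    define E where "E = exp (2 * K * (t - a))"
    have E: "E \<ge> 1" using K t by (simp add: E_def)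
    have int: "h (apply_bcontfun f) integrable_on {a..t}" for f :: "real \<Rightarrow>\<^sub>C real"
      by (intro integrable_continuous_real continuous_on_subset[OF h_cont[of f]]) (use t in auto)
    have prim: "((\<lambda>\<tau>. K * exp (2 * K * (\<tau> - a)) * dist f g) has_integral
        (exp (2 * K * (t - a)) * dist f g / 2 - exp (2 * K * (a - a)) * dist f g / 2)) {a..t}"
      by (rule fundamental_theorem_of_calculus)
        (use t in \<open>auto intro!: derivative_eq_intros
          simp: has_real_derivative_iff_has_vector_derivative[symmetric]\<close>)
    have "\<bar>integral {a..t} (h f) - integral {a..t} (h g)\<bar>
        = \<bar>integral {a..t} (\<lambda>\<tau>. h f \<tau> - h g \<tau>)\<bar>"
      by (simp add: integral_diff int)
    also have "\<dots> \<le> integral {a..t} (\<lambda>\<tau>. K * exp (2 * K * (\<tau> - a)) * dist f g)"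
    proof (rule integral_norm_bound_integral[where 'a=real, unfolded real_norm_def])
      show "(\<lambda>\<tau>. h f \<tau> - h g \<tau>) integrable_on {a..t}" by (intro integrable_diff int)
      show "(\<lambda>\<tau>. K * exp (2 * K * (\<tau> - a)) * dist f g) integrable_on {a..t}"
        using prim by blast
      fix \<tau> assume \<tau>: "\<tau> \<in> {a..t}"
      have "\<bar>h f \<tau> - h g \<tau>\<bar> \<le> K * \<bar>exp (2 * K * (\<tau> - a)) * f \<tau> - exp (2 * K * (\<tau> - a)) * g \<tau>\<bar>"
        unfolding h_def by (rule lipK) (use \<tau> t in auto)
      also have "\<dots> = K * exp (2 * K * (\<tau> - a)) * dist (f \<tau>) (g \<tau>)"
        by (simp add: dist_real_def abs_mult flip: right_diff_distrib)
      also have "\<dots> \<le> K * exp (2 * K * (\<tau> - a)) * dist f g"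
        by (intro mult_left_mono dist_bounded) (use K in auto)
      finally show "\<bar>h f \<tau> - h g \<tau>\<bar> \<le> K * exp (2 * K * (\<tau> - a)) * dist f g" .
    qed
    also have "\<dots> = (E - 1) * dist f g / 2"
      unfolding integral_unique[OF prim] by (simp add: E_def left_diff_distrib diff_divide_distrib)
    also have "\<dots> \<le> E * (dist f g / 2)"
      by (simp add: algebra_simps)
    finally have 1: "\<bar>integral {a..t} (h f) - integral {a..t} (h g)\<bar> \<le> E * (dist f g / 2)" .
    have I_E: "I x g t = (x + integral {a..t} (h g)) / E" for x and g :: "real \<Rightarrow>\<^sub>C real"
      by (simp add: I_def E_def exp_minus divide_inverse)
    have "\<bar>I x f t - I y g t\<bar>
        = \<bar>(x - y) + (integral {a..t} (h f) - integral {a..t} (h g))\<bar> / E"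
      using E by (simp add: I_E abs_divide algebra_simps flip: diff_divide_distrib)
    also have "\<dots> \<le> (E * \<bar>x - y\<bar> + E * (dist f g / 2)) / E"
    proof (rule divide_right_mono)
      have "\<bar>x - y\<bar> \<le> E * \<bar>x - y\<bar>" using E mult_right_mono[of 1 E "\<bar>x - y\<bar>"] by simp
      then show "\<bar>(x - y) + (integral {a..t} (h f) - integral {a..t} (h g))\<bar>
          \<le> E * \<bar>x - y\<bar> + E * (dist f g / 2)"
        using 1 by linarith
    qed (use E in simp)
    also have "\<dots> = \<bar>x - y\<bar> + dist f g / 2"
      using E by (simp add: field_simps)
    finally show ?thesis .
  qed
  have \<Phi>_dist: "dist (\<Phi> x f) (\<Phi> y g) \<le> \<bar>x - y\<bar> + dist f g / 2" for x y f g
    by (rule dist_bound) (unfold \<Phi> dist_real_def, rule I_dist[OF r])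
  have "\<exists>!g. \<Phi> x g = g" for x
    by (rule banach_fix_type[of "1/2"]) (use \<Phi>_dist[of x _ x] in auto)
  then obtain u where u: "\<Phi> x (u x) = u x" for x by metis
  define \<phi> where "\<phi> x t = exp (2 * K * (t - a)) * u x t" for x t
  have \<phi>_cont: "continuous_on {a..b} (\<phi> x)" for x
    unfolding \<phi>_def by (intro continuous_intros continuous_on_apply_bcontfun)
  have int_eq: "\<phi> x t = x + integral {a..t} (\<lambda>\<tau>. G \<tau> (\<phi> x \<tau>))" if "t \<in> {a..b}" for x t
  proof -
    have "u x t = I x (u x) t"
      using \<Phi>[of x "u x" t] that by (simp add: u r_id)
    then have "\<phi> x t = exp (2 * K * (t - a)) * I x (u x) t"
      by (simp add: \<phi>_def)
    also have "\<dots> = x + integral {a..t} (h (u x))"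
      by (simp add: I_def exp_minus)
    finally show ?thesis by (simp add: h_def \<phi>_def)
  qed
  show thesis
  proof
    show "\<phi> x a = x" for x using int_eq[of a x] ab by simp
    show "(\<phi> x has_real_derivative G t (\<phi> x t)) (at t within {a..b})" if t: "t \<in> {a..b}" for x t
    proof -
      have "((\<lambda>t. x + integral {a..t} (h (u x))) has_real_derivative h (u x) t) (at t within {a..b})"
        by (auto intro!: derivative_eq_intros integral_has_real_derivative h_cont t)
      then have "((\<lambda>t. x + integral {a..t} (\<lambda>\<tau>. G \<tau> (\<phi> x \<tau>))) has_real_derivative G t (\<phi> x t))
          (at t within {a..b})"
        by (simp add: h_def \<phi>_def)
      then show ?thesis
        by (rule has_field_derivative_transform_within[OF _ zero_less_one t]) (simp add: int_eq)
    qed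
    show "continuous_on UNIV (\<lambda>x. \<phi> x t)" if t: "t \<in> {a..b}" for t
    proof -
      have "dist (u x) (u y) \<le> 2 * \<bar>x - y\<bar>" for x y
        using \<Phi>_dist[of x "u x" y "u y"] by (simp add: u)
      then have "2-lipschitz_on UNIV (\<lambda>x. u x t)"
        by (intro lipschitz_onI)
          (auto simp: dist_real_def[symmetric] intro: order_trans[OF dist_bounded])
      then have "continuous_on UNIV (\<lambda>x. u x t)" by (rule lipschitz_on_continuous_on)
      then show ?thesis unfolding \<phi>_def by (intro continuous_intros)
    qed
  qed
qed

section \<open>Closed solutions between a lower and an upper solution\<close>

text \<open>
  After the last time at which it is nonpositive the function could only decrease, so it never
  becomes positive. This is how a solution is kept on one side of an upper or lower solution.
\<close>

lemma nonpos_barrier: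
  fixes h h' :: "real \<Rightarrow> real"
  assumes der: "\<And>t. t \<in> {a..b} \<Longrightarrow> (h has_real_derivative h' t) (at t within {a..b})"
    and start: "h a \<le> 0"
    and le: "\<And>t. t \<in> {a..b} \<Longrightarrow> 0 < h t \<Longrightarrow> h' t \<le> 0"
    and s: "s \<in> {a..b}"
  shows "h s \<le> 0"
proof (rule ccontr)
  assume "\<not> h s \<le> 0"
  then have pos: "h s > 0" by simp
  have cont: "continuous_on {a..s} h"
    by (rule continuous_on_subset[of "{a..b}"]) (use s in \<open>auto intro: DERIV_continuous_on der\<close>)
  define S where "S = {a..s} \<inter> h -` {..0}"
  have "closed S" unfolding S_def by (rule continuous_closed_preimage[OF cont]) auto
  moreover have S: "a \<in> S" "bdd_above S" using start s by (auto simp: S_def)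
  ultimately have "Sup S \<in> S" by (intro closed_contains_Sup) auto
  define p where "p = Sup S"
  have p: "p \<in> {a..s}" "h p \<le> 0" using \<open>Sup S \<in> S\<close> by (auto simp: S_def p_def)
  have "p < s" using p pos by (cases "p = s") auto
  have after: "h t > 0" if "t \<in> {p<..<s}" for t
  proof (rule ccontr)
    assume "\<not> h t > 0"
    then have "t \<in> S" using that p by (auto simp: S_def)
    then have "t \<le> p" unfolding p_def using S by (intro cSup_upper)
    then show False using that by simp
  qed
  have "\<exists>x\<in>{p<..<s}. h s - h p = h' x * (s - p)"
  proof (rule mvt_simple[OF \<open>p < s\<close>])
    fix x assume "p \<le> x" "x \<le> s"
    then have "(h has_real_derivative h' x) (at x within {p..s})"
      by (intro DERIV_subset[OF der]) (use p s in auto)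
    then show "(h has_derivative (*) (h' x)) (at x within {p..s})"
      by (simp add: has_field_derivative_def)
  qed
  then obtain x where x: "x \<in> {p<..<s}" "h s - h p = h' x * (s - p)" by blast
  have "h' x \<le> 0" by (rule le) (use x after p s in auto)
  then have "h' x * (s - p) \<le> 0" using \<open>p < s\<close> by (simp add: mult_nonpos_nonneg)
  then show False using x p pos by linarith
qed

text \<open>
  The method of upper and lower solutions for the periodic problem. Beyond the curve \<open>v\<close> the truncated
  field equals \<open>f t (v t) \<le> v' t\<close>, so a solution above \<open>v\<close> cannot move away from it, and likewise for
  \<open>u\<close>. Hence solutions that start between the curves stay between them, where the truncated field is
  \<open>f\<close> itself; for this reason a Lipschitz bound on \<open>f\<close> between the curves is enough.
\<close>

lemma closed_solution_between_lower_upper: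
  fixes f :: "real \<Rightarrow> real \<Rightarrow> real" and u v u' v' :: "real \<Rightarrow> real"
  assumes ab: "a \<le> b"
    and cont: "continuous_on ({a..b} \<times> UNIV) (\<lambda>(t,x). f t x)"
    and lip: "\<And>t x y. t \<in> {a..b} \<Longrightarrow> x \<in> {u t..v t} \<Longrightarrow> y \<in> {u t..v t}
      \<Longrightarrow> \<bar>f t x - f t y\<bar> \<le> L * \<bar>x - y\<bar>"
    and uv: "\<And>t. t \<in> {a..b} \<Longrightarrow> u t \<le> v t"
    and u: "\<And>t. t \<in> {a..b} \<Longrightarrow> (u has_real_derivative u' t) (at t within {a..b})"
      "\<And>t. t \<in> {a..b} \<Longrightarrow> u' t \<le> f t (u t)" "u a \<le> u b"
    and v: "\<And>t. t \<in> {a..b} \<Longrightarrow> (v has_real_derivative v' t) (at t within {a..b})"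
      "\<And>t. t \<in> {a..b} \<Longrightarrow> f t (v t) \<le> v' t" "v b \<le> v a"
  obtains x where "\<And>t. t \<in> {a..b} \<Longrightarrow> (x has_real_derivative f t (x t)) (at t within {a..b})"
    and "x a = x b"
proof -
  define q where "q t x = max (u t) (min (v t) x)" for t x
  define G where "G t x = f t (q t x)" for t x
  have q: "q t x \<in> {u t..v t}" if "t \<in> {a..b}" for t x
    using uv[OF that] by (auto simp: q_def)
  have "continuous_on ({a..b} \<times> UNIV) (\<lambda>(t,x). G t x)"
  proof -
    have "continuous_on ({a..b} \<times> (UNIV :: real set)) (\<lambda>p. u (fst p))"
      "continuous_on ({a..b} \<times> (UNIV :: real set)) (\<lambda>p. v (fst p))"
      by (rule continuous_on_compose2[of "{a..b}"];
          auto intro!: DERIV_continuous_on[OF u(1)] DERIV_continuous_on[OF v(1)] continuous_intros)+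
    then have "continuous_on ({a..b} \<times> UNIV) ((\<lambda>(t,x). f t x) \<circ> (\<lambda>p. (fst p, q (fst p) (snd p))))"
      unfolding q_def
      by (intro continuous_on_compose continuous_on_subset[OF cont] continuous_intros) auto
    then show ?thesis by (simp add: G_def o_def case_prod_beta)
  qed
  moreover have "\<bar>G t x - G t y\<bar> \<le> max L 0 * \<bar>x - y\<bar>" if t: "t \<in> {a..b}" for t x y
  proof -
    have "\<bar>G t x - G t y\<bar> \<le> L * \<bar>q t x - q t y\<bar>"
      unfolding G_def by (intro lip q t)
    also have "\<dots> \<le> max L 0 * \<bar>q t x - q t y\<bar>" by (intro mult_right_mono) auto
    also have "\<dots> \<le> max L 0 * \<bar>x - y\<bar>"
      by (intro mult_left_mono) (auto simp: q_def)
    finally show ?thesis .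
  qed
  ultimately obtain \<phi> where start: "\<And>x. \<phi> x a = x"
    and der: "\<And>x t. t \<in> {a..b} \<Longrightarrow> (\<phi> x has_real_derivative G t (\<phi> x t)) (at t within {a..b})"
    and dep: "\<And>t. t \<in> {a..b} \<Longrightarrow> continuous_on UNIV (\<lambda>x. \<phi> x t)"
    using lipschitz_flow[OF ab, of G "max L 0"] by blast
  have upper: "\<phi> x t \<le> v t" if x: "x \<in> {u a..v a}" and t: "t \<in> {a..b}" for x t
  proof -
    have "\<phi> x t - v t \<le> 0"
    proof (rule nonpos_barrier[where h = "\<lambda>t. \<phi> x t - v t" and a = a and b = b
          and h' = "\<lambda>t. G t (\<phi> x t) - v' t"])
      fix s assume s: "s \<in> {a..b}"
      show "((\<lambda>t. \<phi> x t - v t) has_real_derivative G s (\<phi> x s) - v' s) (at s within {a..b})"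
        by (intro DERIV_diff der v s)
      assume "0 < \<phi> x s - v s"
      then have "q s (\<phi> x s) = v s" using uv[OF s] by (auto simp: q_def)
      then show "G s (\<phi> x s) - v' s \<le> 0" using v(2)[OF s] by (simp add: G_def)
    qed (use x t start in auto)
    then show ?thesis by simp
  qed
  have lower: "u t \<le> \<phi> x t" if x: "x \<in> {u a..v a}" and t: "t \<in> {a..b}" for x t
  proof -
    have "u t - \<phi> x t \<le> 0"
    proof (rule nonpos_barrier[where h = "\<lambda>t. u t - \<phi> x t" and a = a and b = b
          and h' = "\<lambda>t. u' t - G t (\<phi> x t)"])
      fix s assume s: "s \<in> {a..b}"
      show "((\<lambda>t. u t - \<phi> x t) has_real_derivative u' s - G s (\<phi> x s)) (at s within {a..b})"
        by (intro DERIV_diff der u s)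
      assume "0 < u s - \<phi> x s"
      then have "q s (\<phi> x s) = u s" using uv[OF s] by (auto simp: q_def)
      then show "u' s - G s (\<phi> x s) \<le> 0" using u(2)[OF s] by (simp add: G_def)
    qed (use x t start in auto)
    then show ?thesis by simp
  qed
  have a: "a \<in> {a..b}" and b: "b \<in> {a..b}" using ab by auto
  have "\<exists>x. u a \<le> x \<and> x \<le> v a \<and> x - \<phi> x b = 0"
  proof (rule IVT')
    show "u a \<le> v a" by (rule uv[OF a])
    show "u a - \<phi> (u a) b \<le> 0" using lower[of "u a" b] uv[OF a] u(3) b by auto
    show "0 \<le> v a - \<phi> (v a) b" using upper[of "v a" b] uv[OF a] v(3) b by auto
    show "continuous_on {u a..v a} (\<lambda>x. x - \<phi> x b)"
      by (intro continuous_intros continuous_on_subset[OF dep[OF b]]) auto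
  qed
  then obtain x where x: "x \<in> {u a..v a}" "\<phi> x b = x" by auto
  show thesis
  proof
    fix t assume t: "t \<in> {a..b}"
    have "q t (\<phi> x t) = \<phi> x t" using upper[OF x(1) t] lower[OF x(1) t] by (auto simp: q_def)
    then show "(\<phi> x has_real_derivative f t (\<phi> x t)) (at t within {a..b})"
      using der[OF t, of x] by (simp add: G_def)
  next
    show "\<phi> x a = \<phi> x b" using x start by simp
  qed
qed

section \<open>Cubic equations whose leading coefficient is nonpositive\<close>

text \<open>
  Young's inequality in the form that trades the quadratic term for a linear one: the difference of
  the two sides is \<open>w / (2 p)\<close> times the square \<open>(p w - \<beta>)\<^sup>2\<close>.
\<close>

lemma quadratic_le_half_cubic:
  fixes \<beta> p w :: real
  assumes "p > 0" "w \<ge> 0"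
  shows "\<beta> * w^2 \<le> p / 2 * w^3 + \<beta>^2 / (2 * p) * w"
proof -
  have "p / 2 * w^3 + \<beta>^2 / (2 * p) * w - \<beta> * w^2 = w / (2 * p) * (p * w - \<beta>)^2"
    using assms by (simp add: field_simps power2_eq_square power3_eq_cube)
  also have "\<dots> \<ge> 0" using assms by simp
  finally show ?thesis by simp
qed

text \<open>
  For \<open>\<sigma> = 1\<close> and \<open>\<sigma> = - 1\<close> this bounds the outward speed of the cubic field at \<open>w\<close> and at \<open>- w\<close> by the
  same multiple of \<open>w\<close>, so one function serves as an upper and, negated, as a lower solution. The
  quotient \<open>B\<^sup>2 / (- A)\<close> is singular where \<open>A\<close> vanishes; the shift by \<open>\<epsilon>\<close> removes the singularity, and it
  costs only \<open>\<epsilon> w\<^sup>3 / 2\<close>, which is at most \<open>w / 2\<close> as long as \<open>w \<le> \<epsilon> powr (- 1/2)\<close>.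
\<close>

lemma cubic_growth_bound:
  fixes A B C D w \<epsilon> \<sigma> :: real
  assumes "A \<le> 0" "\<epsilon> > 0" "w \<ge> 1" "\<epsilon> * w^2 \<le> 1" and \<sigma>: "\<bar>\<sigma>\<bar> = 1"
  shows "\<sigma> * (A * (\<sigma> * w)^3 + B * (\<sigma> * w)^2 + C * (\<sigma> * w) + D)
    \<le> (A / 2 * w^2 + (B^2 / (2 * (\<epsilon> - A)) + 1/2 + \<bar>C\<bar> + \<bar>D\<bar>)) * w"
proof -
  have "\<sigma> * (A * (\<sigma> * w)^3 + B * (\<sigma> * w)^2 + C * (\<sigma> * w) + D)
      = A * w^3 + \<sigma> * B * w^2 + C * w + \<sigma> * D"
    using \<sigma> by (auto simp: abs_if split: if_splits simp: algebra_simps power2_eq_square power3_eq_cube)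
  also have "\<sigma> * B * w^2 \<le> (\<epsilon> - A) / 2 * w^3 + (\<sigma> * B)^2 / (2 * (\<epsilon> - A)) * w"
    by (rule quadratic_le_half_cubic) (use assms in auto)
  also have "(\<sigma> * B)^2 = B^2" using \<sigma> by (metis abs_mult mult_1 power2_abs)
  also have "A * w^3 + ((\<epsilon> - A) / 2 * w^3 + B^2 / (2 * (\<epsilon> - A)) * w) + C * w + \<sigma> * D
      = (A / 2 * w^2 + B^2 / (2 * (\<epsilon> - A)) + \<epsilon> * w^2 / 2 + C) * w + \<sigma> * D"
    by (simp add: algebra_simps power2_eq_square power3_eq_cube add_divide_distrib diff_divide_distrib)
  also have "\<dots> \<le> (A / 2 * w^2 + B^2 / (2 * (\<epsilon> - A)) + 1 / 2 + \<bar>C\<bar>) * w + \<bar>D\<bar> * w"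
  proof (rule add_mono)
    show "(A / 2 * w^2 + B^2 / (2 * (\<epsilon> - A)) + \<epsilon> * w^2 / 2 + C) * w
        \<le> (A / 2 * w^2 + B^2 / (2 * (\<epsilon> - A)) + 1 / 2 + \<bar>C\<bar>) * w"
      using assms by (intro mult_right_mono) auto
    have "\<sigma> * D \<le> \<bar>D\<bar> * 1" using \<sigma> by (metis abs_ge_self abs_mult mult.commute)
    also have "\<dots> \<le> \<bar>D\<bar> * w" using assms by (intro mult_left_mono) auto
    finally show "\<sigma> * D \<le> \<bar>D\<bar> * w" .
  qed
  also have "\<dots> = (A / 2 * w^2 + (B^2 / (2 * (\<epsilon> - A)) + 1/2 + \<bar>C\<bar> + \<bar>D\<bar>)) * w"
    by (simp add: algebra_simps)
  finally show ?thesis by simp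
qed

lemma cubic_lipschitz:
  fixes A B C D x y :: real
  assumes "\<bar>A\<bar> \<le> S" "\<bar>B\<bar> \<le> S" "\<bar>C\<bar> \<le> S" "\<bar>x\<bar> \<le> M" "\<bar>y\<bar> \<le> M"
  shows "\<bar>(A * x^3 + B * x^2 + C * x + D) - (A * y^3 + B * y^2 + C * y + D)\<bar>
    \<le> S * (3 * M^2 + 2 * M + 1) * \<bar>x - y\<bar>"
proof -
  have "\<bar>A * (x^2 + x * y + y^2) + B * (x + y) + C\<bar>
      \<le> \<bar>A\<bar> * \<bar>x^2 + x * y + y^2\<bar> + \<bar>B\<bar> * \<bar>x + y\<bar> + \<bar>C\<bar>"
    by (simp add: abs_mult[symmetric])
  also have "\<dots> \<le> S * (3 * M^2) + S * (2 * M) + S"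
  proof -
    have "\<bar>x\<bar> * \<bar>x\<bar> \<le> M * M" "\<bar>y\<bar> * \<bar>y\<bar> \<le> M * M" "\<bar>x\<bar> * \<bar>y\<bar> \<le> M * M"
      using assms(4,5) by - (rule mult_mono; linarith)+
    then have quadratic: "\<bar>x^2 + x * y + y^2\<bar> \<le> 3 * M^2"
      unfolding abs_mult[symmetric] power2_eq_square by linarith
    have linear: "\<bar>x + y\<bar> \<le> 2 * M" using assms(4,5) by linarith
    have "0 \<le> S" using assms(1) by linarith
    then show ?thesis
      by (intro add_mono mult_mono assms(1-3) quadratic linear abs_ge_zero)
  qed
  also have "\<dots> = S * (3 * M^2 + 2 * M + 1)" by (simp add: algebra_simps)
  finally have "\<bar>A * (x^2 + x * y + y^2) + B * (x + y) + C\<bar> * \<bar>x - y\<bar>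
      \<le> S * (3 * M^2 + 2 * M + 1) * \<bar>x - y\<bar>"
    by (intro mult_right_mono) auto
  moreover have "(A * x^3 + B * x^2 + C * x + D) - (A * y^3 + B * y^2 + C * y + D)
      = (A * (x^2 + x * y + y^2) + B * (x + y) + C) * (x - y)"
    by (simp add: algebra_simps power2_eq_square power3_eq_cube)
  ultimately show ?thesis by (simp only: abs_mult)
qed

text \<open>
  The upper solution is \<open>w = exp g\<close> with \<open>g' = P - N \<bar>A\<bar> / 2\<close>, where \<open>P\<close> is the linear growth rate of
  \<open>cubic_growth_bound\<close>. Writing \<open>c0\<close> for a bound on the integral of \<open>P\<close>, the choice of \<open>N\<close> makes the
  integral of \<open>N \<bar>A\<bar> / 2\<close> equal to \<open>c0\<close>, whence \<open>g r \<le> g l\<close> and \<open>g\<close> deviates from its initial value \<open>ln K\<close>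
  by at most \<open>c0\<close>. The rate \<open>P\<close> depends on \<open>\<epsilon>\<close>, which has to be small compared with the maximum \<open>M\<close> of
  \<open>w\<close>; this is not circular, because the bound \<open>J\<close>, and with it \<open>c0\<close>, \<open>N\<close>, \<open>K\<close> and \<open>M\<close>, is uniform in \<open>\<epsilon>\<close>.
\<close>

lemma cubic_closed_solution:
  fixes A B C D :: "real \<Rightarrow> real"
  assumes lr: "l \<le> r"
    and cont: "continuous_on {l..r} A" "continuous_on {l..r} B"
      "continuous_on {l..r} C" "continuous_on {l..r} D"
    and nonpos: "\<And>t. t \<in> {l..r} \<Longrightarrow> A t \<le> 0"
    and neg: "integral {l..r} A < 0"
    and bound: "\<And>\<epsilon>. \<epsilon> > 0 \<Longrightarrow> integral {l..r} (\<lambda>t. B t ^ 2 / (\<epsilon> - A t)) \<le> J"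
  obtains x where "\<And>t. t \<in> {l..r} \<Longrightarrow>
      (x has_real_derivative A t * x t ^ 3 + B t * x t ^ 2 + C t * x t + D t) (at t within {l..r})"
    and "x l = x r"
proof -
  define c0 where "c0 = J / 2 + integral {l..r} (\<lambda>t. 1/2 + \<bar>C t\<bar> + \<bar>D t\<bar>)"
  define N where "N = c0 / integral {l..r} (\<lambda>t. - A t / 2)"
  \<comment> \<open>This \<open>K\<close> makes \<open>w \<ge> K exp (- c0)\<close> at least \<open>1\<close>, so that \<open>\<bar>D\<bar> \<le> \<bar>D\<bar> w\<close>, and at least
    \<open>N\<close>; together this gives \<open>w\<^sup>2 \<ge> N\<close>.\<close>
  define K where "K = exp c0 * max 1 N"
  define M where "M = K * exp c0"
  define \<epsilon> where "\<epsilon> = 1 / M^2"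
  define P where "P t = B t ^ 2 / (2 * (\<epsilon> - A t)) + 1/2 + \<bar>C t\<bar> + \<bar>D t\<bar>" for t
  define g where "g t = ln K + integral {l..t} (\<lambda>s. P s - N * (- A s / 2))" for t
  define w where "w t = exp (g t)" for t
  have int_A: "integral {l..r} (\<lambda>t. - A t / 2) > 0"
    using neg by simp
  have "K > 0" "M > 0" by (auto simp: K_def M_def)
  then have \<epsilon>: "\<epsilon> > 0" by (simp add: \<epsilon>_def)
  have cont_P: "continuous_on {l..r} P"
    unfolding P_def by (intro continuous_intros cont) (use \<epsilon> nonpos in force)
  have P_nonneg: "P t \<ge> 0" if "t \<in> {l..r}" for t
    using \<epsilon> nonpos[OF that] unfolding P_def by (intro add_nonneg_nonneg) auto
  have cont_B: "continuous_on {l..r} (\<lambda>t. B t ^ 2 / (\<epsilon> - A t))"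
    by (intro continuous_intros cont) (use \<epsilon> nonpos in force)
  have int_P: "integral {l..r} P \<le> c0"
  proof -
    have "integral {l..r} P
        = integral {l..r} (\<lambda>t. B t ^ 2 / (\<epsilon> - A t) / 2 + (1/2 + \<bar>C t\<bar> + \<bar>D t\<bar>))"
      by (rule integral_cong) (simp add: P_def)
    also have "\<dots> = integral {l..r} (\<lambda>t. B t ^ 2 / (\<epsilon> - A t) / 2)
        + integral {l..r} (\<lambda>t. 1/2 + \<bar>C t\<bar> + \<bar>D t\<bar>)"
      by (intro integral_add integrable_continuous_real continuous_intros cont cont_B) auto
    also have "\<dots> \<le> c0" using bound[OF \<epsilon>] unfolding integral_divide c0_def by linarith
    finally show ?thesis .
  qed
  have partial: "0 \<le> integral {l..t} f \<and> integral {l..t} f \<le> integral {l..r} f"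
    if t: "t \<in> {l..r}" and f: "continuous_on {l..r} f" "\<And>t. t \<in> {l..r} \<Longrightarrow> f t \<ge> 0"
    for t and f :: "real \<Rightarrow> real"
  proof -
    have f': "f integrable_on {l..t}" "f integrable_on {l..r}"
      using t by (auto intro!: integrable_continuous_real continuous_on_subset[OF f(1)])
    show ?thesis
      using t f(2) by (intro conjI integral_nonneg integral_subset_le f') auto
  qed
  have c0: "c0 \<ge> 0" using partial[OF _ cont_P P_nonneg, of r] lr int_P by auto
  then have N: "N \<ge> 0" unfolding N_def using int_A by (intro divide_nonneg_pos)
  have g_split: "g t = ln K + integral {l..t} P - N * integral {l..t} (\<lambda>s. - A s / 2)"
    if t: "t \<in> {l..r}" for t
  proof -
    have "P integrable_on {l..t}" "(\<lambda>s. N * (- A s / 2)) integrable_on {l..t}"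
      using t by (auto intro!: integrable_continuous_real continuous_intros
        continuous_on_subset[OF cont_P] continuous_on_subset[OF cont(1)])
    then have "integral {l..t} (\<lambda>s. P s - N * (- A s / 2))
        = integral {l..t} P - integral {l..t} (\<lambda>s. N * (- A s / 2))"
      by (rule integral_diff)
    then show ?thesis by (simp only: g_def integral_mult_right)
  qed
  have NA: "N * integral {l..r} (\<lambda>s. - A s / 2) = c0"
    using int_A by (simp add: N_def)
  have g_bounds: "ln K - c0 \<le> g t" "g t \<le> ln K + c0" if t: "t \<in> {l..r}" for t
  proof -
    let ?Q = "\<lambda>t. integral {l..t} (\<lambda>s. - A s / 2)"
    have Q: "0 \<le> ?Q t \<and> ?Q t \<le> ?Q r"
      by (rule partial[OF t]) (use nonpos in \<open>auto intro!: continuous_intros cont\<close>)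
    have "0 \<le> N * ?Q t" using N conjunct1[OF Q] by (rule mult_nonneg_nonneg)
    moreover have "N * ?Q t \<le> c0"
      using mult_left_mono[OF conjunct2[OF Q] N] unfolding NA .
    moreover have "0 \<le> integral {l..t} P" "integral {l..t} P \<le> c0"
      using partial[OF t cont_P P_nonneg] int_P by auto
    ultimately show "ln K - c0 \<le> g t" "g t \<le> ln K + c0"
      using g_split[OF t] by auto
  qed
  have w_low: "max 1 N \<le> w t" if t: "t \<in> {l..r}" for t
  proof -
    have "exp (ln K - c0) \<le> w t" using g_bounds(1)[OF t] by (simp add: w_def)
    moreover have "exp (ln K - c0) = max 1 N"
      using \<open>K > 0\<close> by (simp add: exp_diff) (simp add: K_def)
    ultimately show ?thesis by simp
  qed
  have w_up: "w t \<le> M" if t: "t \<in> {l..r}" for t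
  proof -
    have "w t \<le> exp (ln K + c0)" using g_bounds(2)[OF t] by (simp add: w_def)
    also have "\<dots> = M" using \<open>K > 0\<close> by (simp add: exp_add M_def)
    finally show ?thesis .
  qed
  have "g r \<le> g l"
    using g_split[of r] g_split[of l] lr int_P NA by (simp add: g_def)
  then have w_ends: "w r \<le> w l" by (simp add: w_def)
  have w_der: "(w has_real_derivative (P t - N * (- A t / 2)) * w t) (at t within {l..r})"
    if t: "t \<in> {l..r}" for t
  proof -
    have "continuous_on {l..r} (\<lambda>s. P s - N * (- A s / 2))"
      by (intro continuous_intros cont_P cont) auto
    then have "(g has_real_derivative P t - N * (- A t / 2)) (at t within {l..r})"
      unfolding g_def using t by (auto intro!: derivative_eq_intros integral_has_real_derivative)
    from DERIV_chain2[OF DERIV_exp this] show ?thesis by (simp add: w_def[abs_def] mult.commute)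
  qed
  define f where "f t x = A t * x ^ 3 + B t * x ^ 2 + C t * x + D t" for t x
  have growth: "\<sigma> * f t (\<sigma> * w t) \<le> (P t - N * (- A t / 2)) * w t"
    if t: "t \<in> {l..r}" and \<sigma>: "\<bar>\<sigma>\<bar> = 1" for t \<sigma>
  proof -
    have w: "w t \<ge> 1" "w t \<ge> N" "w t \<le> M" using w_low[OF t] w_up[OF t] by auto
    have "\<epsilon> * w t ^ 2 \<le> \<epsilon> * M^2"
      using w \<epsilon> by (intro mult_left_mono power_mono) auto
    also have "\<dots> = 1" using \<open>M > 0\<close> by (simp add: \<epsilon>_def)
    finally have "\<sigma> * f t (\<sigma> * w t) \<le> (A t / 2 * w t ^ 2 + P t) * w t"
      unfolding f_def P_def using w \<sigma> \<epsilon> nonpos[OF t] by (intro cubic_growth_bound) auto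
    also have "\<dots> \<le> (P t - N * (- A t / 2)) * w t"
    proof (rule mult_right_mono)
      have "N \<le> w t ^ 2"
        using w N mult_mono[of N "w t" 1 "w t"] by (simp add: power2_eq_square)
      then have "A t / 2 * w t ^ 2 \<le> A t / 2 * N"
        using nonpos[OF t] by (intro mult_left_mono_neg) auto
      then show "A t / 2 * w t ^ 2 + P t \<le> P t - N * (- A t / 2)" by (simp add: algebra_simps)
    qed (use w in auto)
    finally show ?thesis .
  qed
  obtain S where S: "\<And>t. t \<in> {l..r} \<Longrightarrow> \<bar>A t\<bar> \<le> S" "\<And>t. t \<in> {l..r} \<Longrightarrow> \<bar>B t\<bar> \<le> S"
    "\<And>t. t \<in> {l..r} \<Longrightarrow> \<bar>C t\<bar> \<le> S"
  proof -
    have "bounded (A ` {l..r} \<union> B ` {l..r} \<union> C ` {l..r})"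
      by (auto intro!: compact_imp_bounded compact_continuous_image cont)
    then show thesis using that unfolding bounded_iff by (metis UnI1 UnI2 imageI real_norm_def)
  qed
  show thesis
  proof (rule closed_solution_between_lower_upper[where f = f and a = l and b = r
        and u = "\<lambda>t. - w t" and v = w and u' = "\<lambda>t. - ((P t - N * (- A t / 2)) * w t)"
        and v' = "\<lambda>t. (P t - N * (- A t / 2)) * w t" and L = "S * (3 * M^2 + 2 * M + 1)"])
    have lift: "continuous_on ({l..r} \<times> (UNIV :: real set)) (\<lambda>p. h (fst p))"
      if "continuous_on {l..r} h" for h :: "real \<Rightarrow> real"
      by (rule continuous_on_compose2[OF that]) (auto intro!: continuous_intros)
    show "continuous_on ({l..r} \<times> UNIV) (\<lambda>(t,x). f t x)"
      unfolding f_def case_prod_beta by (intro continuous_intros cont[THEN lift])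
    show "\<bar>f t x - f t y\<bar> \<le> S * (3 * M^2 + 2 * M + 1) * \<bar>x - y\<bar>"
      if "t \<in> {l..r}" "x \<in> {- w t..w t}" "y \<in> {- w t..w t}" for t x y
      unfolding f_def using S that w_up[OF that(1)] by (intro cubic_lipschitz) auto
    show "- ((P t - N * (- A t / 2)) * w t) \<le> f t (- w t)" if "t \<in> {l..r}" for t
      using growth[OF that, of "-1"] by simp
    show "f t (w t) \<le> (P t - N * (- A t / 2)) * w t" if "t \<in> {l..r}" for t
      using growth[OF that, of 1] by simp
    show "((\<lambda>t. - w t) has_real_derivative - ((P t - N * (- A t / 2)) * w t)) (at t within {l..r})"
      if "t \<in> {l..r}" for t by (intro DERIV_minus w_der that)
  qed (use lr w_ends w_der that in \<open>auto simp: f_def w_def\<close>)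
qed

section \<open>Leading coefficients that are negative almost everywhere\<close>

lemma AE_lebesgue_imp_negligible:
  assumes "AE t in lebesgue. t \<in> S \<longrightarrow> P t"
  shows "negligible {t \<in> S. \<not> P t}"
proof -
  obtain N where "N \<in> null_sets lebesgue" "{t \<in> space lebesgue. \<not> (t \<in> S \<longrightarrow> P t)} \<subseteq> N"
    using assms unfolding eventually_ae_filter by blast
  then show ?thesis
    unfolding negligible_iff_null_sets[symmetric] by (auto elim: negligible_subset)
qed

text \<open>
  The positive part of \<open>a\<close> is continuous and nonnegative with integral zero, hence zero everywhere.
\<close>

lemma continuous_AE_neg_imp_nonpos:
  fixes a :: "real \<Rightarrow> real"
  assumes "l < r" and cont: "continuous_on {l..r} a"
    and neg: "AE t in lebesgue. t \<in> {l..r} \<longrightarrow> a t < 0"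
    and t: "t \<in> {l..r}"
  shows "a t \<le> 0"
proof -
  have "integral {l..r} (\<lambda>t. max 0 (a t)) = integral {l..r} (\<lambda>t. 0)"
    by (rule integral_spike[OF AE_lebesgue_imp_negligible[OF neg]]) auto
  moreover have "continuous_on {l..r} (\<lambda>t. max 0 (a t))"
    by (intro continuous_intros cont)
  ultimately have "\<forall>t\<in>{l..r}. max 0 (a t) = 0"
    using integral_eq_0_iff[of l r "\<lambda>t. max 0 (a t)"] \<open>l < r\<close> by simp
  then show ?thesis using t by (metis max.cobounded2)
qed

lemma continuous_AE_neg_imp_integral_neg:
  fixes a :: "real \<Rightarrow> real"
  assumes "l < r" and cont: "continuous_on {l..r} a"
    and neg: "AE t in lebesgue. t \<in> {l..r} \<longrightarrow> a t < 0"
  shows "integral {l..r} a < 0"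
proof -
  note nonpos = continuous_AE_neg_imp_nonpos[OF assms]
  have cont': "continuous_on {l..r} (\<lambda>t. - a t)" by (intro continuous_intros cont)
  have "integral {l..r} (\<lambda>t. - a t) \<ge> 0"
    by (intro integral_nonneg integrable_continuous_real cont') (simp add: nonpos)
  moreover have "integral {l..r} (\<lambda>t. - a t) \<noteq> 0"
  proof
    assume "integral {l..r} (\<lambda>t. - a t) = 0"
    then have "\<forall>t\<in>{l..r}. - a t = 0"
      using integral_eq_0_iff[OF cont'] nonpos \<open>l < r\<close> by simp
    then have "{t \<in> {l..r}. \<not> a t < 0} = {l..r}" by auto
    then have "negligible {l..r}" using AE_lebesgue_imp_negligible[OF neg] by simp
    then show False using \<open>l < r\<close> negligible_interval(1)[of l r] by simp
  qed
  ultimately show ?thesis by simp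
qed

text \<open>
  Only the value of the integral of \<open>b\<^sup>2 / a\<close> enters the bound, not \<open>\<epsilon>\<close>: as \<open>\<epsilon>\<close> decreases to zero the
  regularised quotients increase to \<open>- (b\<^sup>2 / a)\<close> wherever \<open>a\<close> is negative.
\<close>

lemma integral_regularised_quotient_le:
  fixes a b :: "real \<Rightarrow> real"
  assumes "l < r" and cont: "continuous_on {l..r} a" "continuous_on {l..r} b"
    and neg: "AE t in lebesgue. t \<in> {l..r} \<longrightarrow> a t < 0"
    and int: "set_integrable lebesgue {l..r} (\<lambda>t. b t ^ 2 / a t)"
    and \<epsilon>: "\<epsilon> > 0"
  shows "integral {l..r} (\<lambda>t. b t ^ 2 / (\<epsilon> - a t)) \<le> integral {l..r} (\<lambda>t. - (b t ^ 2 / a t))"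
proof -
  note nonpos = continuous_AE_neg_imp_nonpos[OF \<open>l < r\<close> cont(1) neg]
  define Z where "Z = {t \<in> {l..r}. \<not> a t < 0}"
  have Z: "negligible Z" unfolding Z_def by (rule AE_lebesgue_imp_negligible[OF neg])
  \<comment> \<open>Where \<open>a\<close> vanishes the quotient \<open>b\<^sup>2 / a\<close> is \<open>0\<close> by convention and does not dominate; it is
    altered on this negligible set.\<close>
  let ?h = "\<lambda>t. if t \<in> Z then b t ^ 2 / \<epsilon> else - (b t ^ 2 / a t)"
  have int': "(\<lambda>t. - (b t ^ 2 / a t)) integrable_on {l..r}"
    using set_lebesgue_integral_eq_integral(1)[OF int] by (rule integrable_neg)
  have "integral {l..r} (\<lambda>t. b t ^ 2 / (\<epsilon> - a t)) \<le> integral {l..r} ?h"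
  proof (rule integral_le)
    have "\<forall>t\<in>{l..r}. \<epsilon> - a t \<noteq> 0" using \<epsilon> nonpos by (metis diff_gt_0_iff_gt less_irrefl order_le_less_trans)
    then show "(\<lambda>t. b t ^ 2 / (\<epsilon> - a t)) integrable_on {l..r}"
      by (intro integrable_continuous_real continuous_intros cont)
    show "?h integrable_on {l..r}" by (rule integrable_spike[OF int' Z]) simp
    fix t assume t: "t \<in> {l..r}"
    show "b t ^ 2 / (\<epsilon> - a t) \<le> ?h t"
    proof (cases "t \<in> Z")
      case True
      then have "a t = 0" using nonpos[OF t] by (simp add: Z_def)
      then show ?thesis using True by simp
    next
      case False
      then have "a t < 0" using t by (simp add: Z_def)
      then have "b t ^ 2 / (\<epsilon> - a t) \<le> b t ^ 2 / (- a t)"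
        using \<epsilon> by (intro divide_left_mono mult_pos_pos) auto
      then show ?thesis using False by simp
    qed
  qed
  also have "\<dots> = integral {l..r} (\<lambda>t. - (b t ^ 2 / a t))"
    by (rule integral_spike[OF Z]) simp
  finally show ?thesis .
qed

section \<open>The closed solution\<close>

theorem theorem5p5:
  fixes t0 T \<gamma>1 \<gamma>2 :: real
    and a b c d a1 b1 c1 d1 a2 b2 c2 d2 y1 y2 :: "real \<Rightarrow> real"
  assumes "t0 < T"
    and "continuous_on {t0..T} a" "continuous_on {t0..T} b"
        "continuous_on {t0..T} c" "continuous_on {t0..T} d"
    and "continuous_on {t0..T} a1" "continuous_on {t0..T} b1"
        "continuous_on {t0..T} c1" "continuous_on {t0..T} d1"
    and "continuous_on {t0..T} a2" "continuous_on {t0..T} b2"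
        "continuous_on {t0..T} c2" "continuous_on {t0..T} d2"
    and "abel_solution a1 b1 c1 d1 t0 T y1"
    and "abel_solution a2 b2 c2 d2 t0 T y2"
    and "y1 t0 \<le> y2 t0" and "y1 t0 \<le> y1 T" and "y2 t0 \<ge> y2 T"
    and "AE t in lebesgue. t \<in> {t0..T} \<longrightarrow> a t < 0"
    and "set_integrable lebesgue {t0..T} (\<lambda>t. b t ^ 2 / a t)"
    and "\<gamma>1 \<in> {y1 t0..y2 t0}"
    and "\<forall>t\<in>{t0..T}.
      \<gamma>1 - y1 t0 +
      (LINT \<tau>:{t0..t}|lebesgue.
         exp (LINT s:{t0..\<tau>}|lebesgue. c s - b s ^ 2 / a s) *
         ((a1 \<tau> - a \<tau>) * y1 \<tau> ^ 3 + (b1 \<tau> - b \<tau>) * y1 \<tau> ^ 2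
          + (c1 \<tau> - c \<tau>) * y1 \<tau> + d1 \<tau> - d \<tau>)) \<ge> 0"
    and "\<gamma>2 \<in> {\<gamma>1..y2 t0}"
    and "\<forall>t\<in>{t0..T}.
      \<gamma>2 - y2 t0 +
      (LINT \<tau>:{t0..t}|lebesgue.
         exp (LINT s:{t0..\<tau>}|lebesgue. c s - b s ^ 2 / a s) *
         ((a2 \<tau> - a \<tau>) * y2 \<tau> ^ 3 + (b2 \<tau> - b \<tau>) * y2 \<tau> ^ 2
          + (c2 \<tau> - c \<tau>) * y2 \<tau> + d2 \<tau> - d \<tau>)) \<le> 0"
  shows "\<exists>y. closed_abel_solution a b c d t0 T y"
proof -
  note cont = assms(2-5) and neg = assms(19)
  note bound = integral_regularised_quotient_le[OF assms(1) cont(1,2) neg assms(20)]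
  \<comment> \<open>From here on time runs backwards, over \<open>{-T..-t0}\<close>.\<close>
  have cont_reflect: "continuous_on {-T..-t0} (\<lambda>s. h (- s))" if "continuous_on {t0..T} h"
    for h :: "real \<Rightarrow> real"
    by (rule continuous_on_compose2[OF that]) (auto intro!: continuous_intros)
  obtain x where x: "\<And>s. s \<in> {-T..-t0} \<Longrightarrow> (x has_real_derivative
      a (-s) * x s ^ 3 + b (-s) * x s ^ 2 + c (-s) * x s + d (-s)) (at s within {-T..-t0})"
    and closed: "x (-T) = x (-t0)"
  proof (rule cubic_closed_solution[of "-T" "-t0" "\<lambda>s. a (-s)" "\<lambda>s. b (-s)" "\<lambda>s. c (-s)"
        "\<lambda>s. d (-s)" "integral {t0..T} (\<lambda>t. - (b t ^ 2 / a t))"])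
    show "integral {-T..-t0} (\<lambda>s. b (-s) ^ 2 / (\<epsilon> - a (-s)))
        \<le> integral {t0..T} (\<lambda>t. - (b t ^ 2 / a t))" if "\<epsilon> > 0" for \<epsilon>
      using bound[OF that]
        Henstock_Kurzweil_Integration.integral_reflect_real[of T t0 "\<lambda>t. b t ^ 2 / (\<epsilon> - a t)"]
      by (simp only:)
    show "integral {-T..-t0} (\<lambda>s. a (-s)) < 0"
      using continuous_AE_neg_imp_integral_neg[OF assms(1) cont(1) neg]
        Henstock_Kurzweil_Integration.integral_reflect_real[of T t0 a] by (simp only:)
    show "a (-s) \<le> 0" if "s \<in> {-T..-t0}" for s
      by (rule continuous_AE_neg_imp_nonpos[OF assms(1) cont(1) neg]) (use that in auto)
  qed (use assms(1) cont[THEN cont_reflect] in auto)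
  have "(x \<circ> uminus has_real_derivative
      (a t * x (-t) ^ 3 + b t * x (-t) ^ 2 + c t * x (-t) + d t) * (-1)) (at t within {t0..T})"
    if "t \<in> {t0..T}" for t
  proof (rule DERIV_image_chain)
    show "(x has_real_derivative a t * x (-t) ^ 3 + b t * x (-t) ^ 2 + c t * x (-t) + d t)
        (at (-t) within uminus ` {t0..T})"
      using x[of "-t"] that by simp
    show "(uminus has_real_derivative -1) (at t within {t0..T})"
      by (auto intro!: derivative_eq_intros)
  qed
  then have "abel_solution a b c d t0 T (x \<circ> uminus)"
    unfolding abel_solution_def
    by (intro exI[of _ "\<lambda>t. (a t * x (-t) ^ 3 + b t * x (-t) ^ 2 + c t * x (-t) + d t) * (-1)"]) auto
  then show ?thesis
    using closed by (auto simp: closed_abel_solution_def)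
qed

end
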